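(* Let $d\in\{2,3\}$, let $\Omega\subset\mathbb{R}^d$ be a connected bounded open set which is polygonal ($d=2$) or polyhedral ($d=3$), let $0<T<\infty$, and let $u_0\in L^\infty(\Omega)\cap H^1_0(\Omega)$ satisfy $u_0(x)\ge 0$ for a.e. $x\in\Omega$. Let $\mathcal{M}$ be a simplicial mesh of $\Omega$ of the type described in the context, let $N\ge 1$ be an integer and $\delta t=T/N$. Consider the scheme with unknowns $(u^n)_{0\le n\le N}$, $(\varphi^n)_{0\le n\le N}$ in $H_{\mathcal{M}}(\Omega)$: for all $K\in\mathcal{M}$, \[ \frac{u_K^{n+1}-u_K^n}{\delta t}-(\Delta_{\mathcal{M},\mathrm{D}}(u^{n+1}))_K+|u_K^{n+1}|\,(u_K^{n+1})^3-\varphi_K^n=0,\qquad n=0,\dots,N-1, \] \[ \varphi_K^{n+1}-(\Delta_{\mathcal{M},\mathrm{N}}(\varphi^{n+1}))_K-(u_K^{n+1})^4=0,\qquad n=0,\dots,N-1, \] \[ u_K^0=\frac1{|K|}\int_K u_0(x)\,dx,\qquad \varphi_K^0-(\Delta_{\mathcal{M},\mathrm{N}}(\varphi^0))_K-(u_K^0)^4=0 . \] Then: (1) The scheme has a unique solution. (2) For $0\le n\le N$, the unknown $\varphi^n$ satisfies $0\le\varphi_K^n\le\bigl[\max_{L\in\mathcal{M}}u_L^n\bigr]^4$ for all $K\in\mathcal{M}$. (3) For $1\le n\le N$, the unknown $u^n$ satisfies $0\le u_K^n\le\max_{L\in\mathcal{M}}u_L^{n-1}$ for all $K\in\mathcal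{M}$.
   Context: Mesh: $\mathcal{M}$ is a finite collection of pairwise disjoint (open) $d$-simplices $K$ (control volumes) with $\bar\Omega=\cup_{K\in\mathcal{M}}\bar K$, conforming (two neighbouring simplices share a whole face), and such that for every $K\in\mathcal{M}$ the circumcenter $x_K$ of $K$ lies in $K$. $|K|$ is the measure of $K$, $\mathcal{E}(K)$ the set of faces of $K$; the set of all faces is split into $\mathcal{E}_{\mathrm{int}}$ (internal faces, $\sigma=K|L$ separating two control volumes $K$ and $L$) and $\mathcal{E}_{\mathrm{ext}}$ (faces included in $\partial\Omega$). $|\sigma|$ is the $(d-1)$-dimensional measure of $\sigma$. For $\sigma=K|L$ internal, $d_\sigma$ is the distance between $x_K$ and $x_L$; for $\sigma\in\mathcal{E}_{\mathrm{ext}}\cap\mathcal{E}(K)$, $d_\sigma$ is the distance from $x_K$ to $\sigma$. $H_{\mathcal{M}}(\Omega)\subset L^2(\Omega)$ is the space of functions that are constant on each $K\in\mathcal{M}$; $u_K$ denotes the value of $u$ in $K$. Discrete Laplacians (homogeneous Neumann and Dirichlet conditions): for $\psi\in H_{\mathcal{M}}(\Omega)$ and $K\in\mathcal{M}$, \[ (\Delta_{\mathcal{M},\mathrm{N}}(\psi))_K=\frac1{|K|}\sum_{\sigma=K|L}\frac{|\sigma|}{d_\sigma}(\psi_L-\psi_K), \] (sum over internal faces of $K$), and \[ (\Delta_{\mathcal{M},\mathrm{D}}(\psi))_K=(\Delta_{\mathcal{M},\mathrm{N}}(\psi))_K+\frac1{|K|}\sum_{\sigma\in\mathcal{E}_{\mathrm{ext}}\cap\mathcal{E}(K)}\frac{|\sigma|}{d_\sigma}(-\psi_K).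 \] *)

theory Defs
  imports "HOL-Analysis.Analysis"
begin

definition Linfty :: "'a::euclidean_space set \<Rightarrow> ('a \<Rightarrow> real) set" where
  "Linfty \<Omega> = {f. f \<in> borel_measurable (lebesgue_on \<Omega>) \<and>
                  (\<exists>C. AE x in lebesgue_on \<Omega>. \<bar>f x\<bar> \<le> C)}"

definition L2 :: "'a::euclidean_space set \<Rightarrow> ('a \<Rightarrow> real) set" where
  "L2 \<Omega> = {f. f \<in> borel_measurable (lebesgue_on \<Omega>) \<and>
              integrable (lebesgue_on \<Omega>) (\<lambda>x. (f x)\<^sup>2)}"

definition pderivative :: "'a::euclidean_space \<Rightarrow> ('a \<Rightarrow> real) \<Rightarrow> 'a \<Rightarrow> real" where
  "pderivative b f x = frechet_derivative f (at x) b"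

fun Ck :: "nat \<Rightarrow> ('a::euclidean_space \<Rightarrow> real) \<Rightarrow> bool" where
  "Ck 0 f \<longleftrightarrow> continuous_on UNIV f"
| "Ck (Suc k) f \<longleftrightarrow> (\<forall>x. f differentiable (at x)) \<and> (\<forall>b\<in>Basis. Ck k (pderivative b f))"

definition test_functions :: "'a::euclidean_space set \<Rightarrow> ('a \<Rightarrow> real) set" where
  "test_functions \<Omega> = {f. (\<forall>k. Ck k f) \<and> compact (closure {x. f x \<noteq> 0}) \<and>
                          closure {x. f x \<noteq> 0} \<subseteq> \<Omega>}"

definition weak_pderivative ::
  "'a::euclidean_space set \<Rightarrow> 'a \<Rightarrow> ('a \<Rightarrow> real) \<Rightarrow> ('a \<Rightarrow> real) \<Rightarrow> bool" where
  "weak_pderivative \<Omega> b f g \<longleftrightarrow>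
     (\<forall>\<theta>\<in>test_functions \<Omega>.
        (LINT x|lebesgue_on \<Omega>. f x * pderivative b \<theta> x) = - (LINT x|lebesgue_on \<Omega>. g x * \<theta> x))"

text \<open>The closure of the test functions in the norm of \<open>H\<^sup>1(\<Omega>)\<close>; \<open>g b\<close> is the weak derivative of
  \<open>f\<close> in the direction \<open>b\<close>.\<close>

definition H10 :: "'a::euclidean_space set \<Rightarrow> ('a \<Rightarrow> real) set" where
  "H10 \<Omega> = {f. f \<in> L2 \<Omega> \<and>
     (\<exists>g. (\<forall>b\<in>Basis. g b \<in> L2 \<Omega> \<and> weak_pderivative \<Omega> b f (g b)) \<and>
       (\<exists>\<theta>. (\<forall>k::nat. \<theta> k \<in> test_functions \<Omega>) \<and>
         (\<lambda>k. (LINT x|lebesgue_on \<Omega>. (\<theta> k x - f x)\<^sup>2) +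
              (\<Sum>b\<in>Basis. LINT x|lebesgue_on \<Omega>. (pderivative b (\<theta> k) x - g b x)\<^sup>2))
           \<longlonglongrightarrow> 0))}"

text \<open>An interval, a polygon or a polyhedron has a boundary made of finitely many points,
  segments or plane polygons, respectively.\<close>

definition polyhedral_domain :: "'a::euclidean_space set \<Rightarrow> bool" where
  "polyhedral_domain \<Omega> \<longleftrightarrow> open \<Omega> \<and> bounded \<Omega> \<and>
     (\<exists>F. finite F \<and> frontier \<Omega> = \<Union>F \<and>
          (\<forall>P\<in>F. polytope P \<and> aff_dim P = int DIM('a) - 1))"

text \<open>The \<open>s\<close>-dimensional (outer) Hausdorff measure, normalised so that it agrees with
  \<open>s\<close>-dimensional Lebesgue measure on \<open>s\<close>-dimensional planes (for \<open>s \<ge> 1\<close>).\<close>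

definition hausdorff_measure :: "nat \<Rightarrow> 'a::metric_space set \<Rightarrow> ennreal" where
  "hausdorff_measure s A =
     (SUP \<delta>\<in>{0::real<..}.
        INF C\<in>{C :: nat \<Rightarrow> 'a set. A \<subseteq> (\<Union>i. C i) \<and> (\<forall>i. bounded (C i) \<and> diameter (C i) \<le> \<delta>)}.
          (\<Sum>i. ennreal (unit_ball_vol (real s) * (diameter (C i) / 2) ^ s)))"

definition face_measure :: "'a::euclidean_space set \<Rightarrow> real" where
  "face_measure \<sigma> = enn2real (hausdorff_measure (DIM('a) - 1) \<sigma>)"

definition open_simplex :: "'a::euclidean_space set \<Rightarrow> bool" where
  "open_simplex K \<longleftrightarrow> (\<exists>S. int DIM('a) simplex S \<and> K = interior S)"

definition vertices :: "'a::euclidean_space set \<Rightarrow> 'a set" where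
  "vertices K = {v. v extreme_point_of closure K}"

definition faces :: "'a::euclidean_space set \<Rightarrow> 'a set set" where
  "faces K = {\<sigma>. \<sigma> facet_of closure K}"

definition circumcenter :: "'a::euclidean_space set \<Rightarrow> 'a" where
  "circumcenter K = (THE c. \<exists>r. \<forall>v\<in>vertices K. dist c v = r)"

definition simplicial_mesh :: "'a::euclidean_space set \<Rightarrow> 'a set set \<Rightarrow> bool" where
  "simplicial_mesh \<Omega> M \<longleftrightarrow>
     finite M \<and> (\<forall>K\<in>M. open_simplex K) \<and> disjoint M \<and>
     closure \<Omega> = (\<Union>K\<in>M. closure K) \<and>
     (\<forall>K\<in>M. \<forall>L\<in>M. K \<noteq> L \<longrightarrow> aff_dim (closure K \<inter> closure L) = int DIM('a) - 1 \<longrightarrow>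
        closure K \<inter> closure L \<in> faces K \<inter> faces L) \<and>
     (\<forall>K\<in>M. circumcenter K \<in> K)"

definition ext_faces :: "'a::euclidean_space set \<Rightarrow> 'a set \<Rightarrow> 'a set set" where
  "ext_faces \<Omega> K = {\<sigma>\<in>faces K. \<sigma> \<subseteq> frontier \<Omega>}"

text \<open>The control volumes \<open>L\<close> for which \<open>K|L = closure K \<inter> closure L\<close> is an internal face. A face
  contained in the boundary is external by definition; for two control volumes sharing a face
  this only matters if \<open>\<Omega>\<close> has a slit along that face.\<close>

definition neighbours :: "'a::euclidean_space set \<Rightarrow> 'a set set \<Rightarrow> 'a set \<Rightarrow> 'a set set" where
  "neighbours \<Omega> M K = {L\<in>M. L \<noteq> K \<and> closure K \<inter> closure L \<in> faces K \<inter> faces L \<and>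
                            \<not> closure K \<inter> closure L \<subseteq> frontier \<Omega>}"

text \<open>An element of \<open>H\<^sub>M(\<Omega>)\<close>, a class of functions modulo null sets, is represented by its
  member that vanishes off the (open) control volumes.\<close>

definition HM :: "'a::euclidean_space set set \<Rightarrow> ('a \<Rightarrow> real) set" where
  "HM M = {u. (\<forall>K\<in>M. u constant_on K) \<and> (\<forall>x. x \<notin> \<Union>M \<longrightarrow> u x = 0)}"

definition cell_value :: "('a \<Rightarrow> real) \<Rightarrow> 'a set \<Rightarrow> real" where
  "cell_value u K = (THE c. \<forall>x\<in>K. u x = c)"

definition laplace_N ::
  "'a::euclidean_space set \<Rightarrow> 'a set set \<Rightarrow> ('a \<Rightarrow> real) \<Rightarrow> 'a set \<Rightarrow> real" where
  "laplace_N \<Omega> M \<psi> K = 1 / measure lebesgue K *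
     (\<Sum>L\<in>neighbours \<Omega> M K.
        face_measure (closure K \<inter> closure L) / dist (circumcenter K) (circumcenter L)
          * (cell_value \<psi> L - cell_value \<psi> K))"

definition laplace_D ::
  "'a::euclidean_space set \<Rightarrow> 'a set set \<Rightarrow> ('a \<Rightarrow> real) \<Rightarrow> 'a set \<Rightarrow> real" where
  "laplace_D \<Omega> M \<psi> K = laplace_N \<Omega> M \<psi> K + 1 / measure lebesgue K *
     (\<Sum>\<sigma>\<in>ext_faces \<Omega> K.
        face_measure \<sigma> / infdist (circumcenter K) \<sigma> * (- cell_value \<psi> K))"

text \<open>The families \<open>(u\<^sup>n)\<close> and \<open>(\<phi>\<^sup>n)\<close>, \<open>0 \<le> n \<le> N\<close>, are extensional functions on \<open>{0..N}\<close>.\<close>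

definition scheme_solution ::
  "'a::euclidean_space set \<Rightarrow> 'a set set \<Rightarrow> real \<Rightarrow> nat \<Rightarrow> ('a \<Rightarrow> real) \<Rightarrow>
   (nat \<Rightarrow> 'a \<Rightarrow> real) \<Rightarrow> (nat \<Rightarrow> 'a \<Rightarrow> real) \<Rightarrow> bool" where
  "scheme_solution \<Omega> M T N u0 u \<phi> \<longleftrightarrow>
     u \<in> {0..N} \<rightarrow>\<^sub>E HM M \<and> \<phi> \<in> {0..N} \<rightarrow>\<^sub>E HM M \<and>
     (\<forall>n<N. \<forall>K\<in>M.
        (cell_value (u (Suc n)) K - cell_value (u n) K) / (T / real N)
          - laplace_D \<Omega> M (u (Suc n)) K
          + \<bar>cell_value (u (Suc n)) K\<bar> * cell_value (u (Suc n)) K ^ 3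
          - cell_value (\<phi> n) K = 0) \<and>
     (\<forall>n<N. \<forall>K\<in>M.
        cell_value (\<phi> (Suc n)) K - laplace_N \<Omega> M (\<phi> (Suc n)) K
          - cell_value (u (Suc n)) K ^ 4 = 0) \<and>
     (\<forall>K\<in>M.
        cell_value (u 0) K = 1 / measure lebesgue K * (LINT x:K|lebesgue. u0 x) \<and>
        cell_value (\<phi> 0) K - laplace_N \<Omega> M (\<phi> 0) K - cell_value (u 0) K ^ 4 = 0)"

end

theory Submission
  imports Defs
begin

text \<open>Each equation of the scheme has the form
  \<open>c x\<^sub>K + (\<Sum>L. w\<^sub>K\<^sub>L (x\<^sub>K - x\<^sub>L)) + h\<^sub>K(x\<^sub>K) = f\<^sub>K\<close> with \<open>c > 0\<close>, \<open>w \<ge> 0\<close> and \<open>h\<^sub>K\<close> continuous and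
  increasing (the boundary terms of the Dirichlet Laplacian are part of \<open>h\<^sub>K\<close>). Looking at a
  maximum of the difference of two functions gives a comparison principle, hence uniqueness, and
  the bounds follow by comparing the solution with constants. For existence, the nonlinear Jacobi
  iteration is a contraction in the maximum norm.\<close>

section \<open>Monotone equations on weighted graphs\<close>

locale weighted_graph =
  fixes V :: "'i set" and nb :: "'i \<Rightarrow> 'i set" and w :: "'i \<Rightarrow> 'i \<Rightarrow> real"
  assumes finite_V: "finite V"
    and nb_subset: "K \<in> V \<Longrightarrow> nb K \<subseteq> V"
    and w_nonneg: "K \<in> V \<Longrightarrow> L \<in> nb K \<Longrightarrow> 0 \<le> w K L"
begin

definition lhs :: "real \<Rightarrow> ('i \<Rightarrow> real \<Rightarrow> real) \<Rightarrow> ('i \<Rightarrow> real) \<Rightarrow> 'i \<Rightarrow> real" where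
  "lhs c h x K = c * x K + (\<Sum>L\<in>nb K. w K L * (x K - x L)) + h K (x K)"

lemma lhs_const: "lhs c h (\<lambda>_. a) K = c * a + h K a"
  by (simp add: lhs_def)

lemma lhs_cong:
  assumes "K \<in> V" and "\<And>L. L \<in> V \<Longrightarrow> x L = y L"
  shows "lhs c h x K = lhs c h y K"
proof -
  have "(\<Sum>L\<in>nb K. w K L * (x K - x L)) = (\<Sum>L\<in>nb K. w K L * (y K - y L))"
    using nb_subset[OF assms(1)] assms by (intro sum.cong) auto
  then show ?thesis
    using assms by (simp add: lhs_def)
qed

text \<open>At a maximum of \<open>x - y\<close> the difference of the sums over the neighbours is nonnegative.\<close>

lemma comparison:
  assumes c: "0 < c" and h: "\<And>K. K \<in> V \<Longrightarrow> mono (h K)"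
    and le: "\<And>K. K \<in> V \<Longrightarrow> lhs c h x K \<le> lhs c h y K"
    and K: "K \<in> V"
  shows "x K \<le> y K"
proof -
  define m where "m = Max ((\<lambda>L. x L - y L) ` V)"
  have "m \<in> (\<lambda>L. x L - y L) ` V"
    unfolding m_def using K finite_V by (intro Max_in) auto
  then obtain J where J: "J \<in> V" "m = x J - y J"
    by blast
  have m: "x L - y L \<le> m" if "L \<in> V" for L
    unfolding m_def using that finite_V by auto
  have "m \<le> 0"
  proof (rule ccontr)
    assume "\<not> m \<le> 0"
    then have less: "y J < x J"
      using J by simp
    have "(\<Sum>L\<in>nb J. w J L * (y J - y L)) \<le> (\<Sum>L\<in>nb J. w J L * (x J - x L))"
      using m nb_subset[OF J(1)] w_nonneg[OF J(1)] J(2)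
      by (intro sum_mono mult_left_mono) (auto simp: algebra_simps)
    moreover have "h J (y J) \<le> h J (x J)"
      using h[OF J(1)] less by (simp add: monoD)
    \<comment> \<open>The zeroth-order term supplies the strict inequality that rules out a positive
      maximum.\<close>
    moreover have "c * y J < c * x J"
      using c less by simp
    ultimately show False
      using le[OF J(1)] by (simp add: lhs_def)
  qed
  then show ?thesis
    using m[OF K] by simp
qed

lemma lhs_inj:
  assumes "0 < c" and "\<And>K. K \<in> V \<Longrightarrow> mono (h K)"
    and "\<And>K. K \<in> V \<Longrightarrow> lhs c h x K = lhs c h y K" and "K \<in> V"
  shows "x K = y K"
  using assms comparison[of c h x y K] comparison[of c h y x K] by simp

end

section \<open>Scalar equations with a linear and an increasing term\<close>

lemma strongly_increasing_surj:
  fixes h :: "real \<Rightarrow> real"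
  assumes a: "0 < a" and h: "mono h" "continuous_on UNIV h"
  shows "\<exists>s. a * s + h s = f"
proof -
  \<comment> \<open>At \<open>R\<close> and \<open>- R\<close> the linear term alone bridges the gap
    between \<open>h 0\<close> and \<open>f\<close>; by monotonicity \<open>h\<close> only
    helps.\<close>
  define R where "R = \<bar>f - h 0\<bar> / a"
  have R: "0 \<le> R" "a * R = \<bar>f - h 0\<bar>"
    using a by (simp_all add: R_def)
  have "h (- R) \<le> h 0" "h 0 \<le> h R"
    using h(1) R by (auto simp: mono_def)
  moreover have "a * (- R) = - \<bar>f - h 0\<bar>"
    using R by simp
  ultimately have "a * (- R) + h (- R) \<le> f" "f \<le> a * R + h R"
    using R by linarith+
  moreover have "continuous_on {- R..R} (\<lambda>s. a * s + h s)"
    by (intro continuous_intros continuous_on_subset[OF h(2)]) auto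
  ultimately show ?thesis
    using IVT'[of "\<lambda>s. a * s + h s" "- R" f R] R by auto
qed

text \<open>The increments of \<open>a * s\<close> and of \<open>h s\<close> have the same sign and
  cannot cancel. Hence the solution of the scalar equation is Lipschitz in the right-hand side, with
  constant \<open>1 / a\<close>.\<close>

lemma strongly_increasing_dist:
  fixes h :: "real \<Rightarrow> real"
  assumes a: "0 < a" and h: "mono h"
  shows "a * \<bar>s - t\<bar> \<le> \<bar>(a * s + h s) - (a * t + h t)\<bar>"
proof (cases "t \<le> s")
  case True
  with monoD[OF h True] show ?thesis
    using a mult_left_mono[OF True, of a] by (simp add: algebra_simps abs_if)
next
  case False
  then have "s \<le> t"
    by simp
  from monoD[OF h this] show ?thesis
    using a mult_left_mono[OF \<open>s \<le> t\<close>, of a] by (simp add: algebra_simps abs_if)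
qed

context weighted_graph
begin

text \<open>Solving the equation at each vertex for the value at that vertex, with the values at the
  neighbours given, is a contraction in the maximum norm with factor \<open>W / (c + W)\<close>.\<close>

lemma solvable:
  assumes c: "0 < c" and h: "\<And>K. K \<in> V \<Longrightarrow> mono (h K)" "\<And>K. K \<in> V \<Longrightarrow> continuous_on UNIV (h K)"
  shows "\<exists>x. \<forall>K\<in>V. lhs c h x K = f K"
proof -
  define \<omega> where "\<omega> K = (\<Sum>L\<in>nb K. w K L)" for K
  \<comment> \<open>The sum over all vertices is a crude common bound for the
    \<open>\<omega> K\<close>, giving one contraction factor for all of them.\<close>
  define W where "W = (\<Sum>K\<in>V. \<omega> K)"
  define q where "q = W / (c + W)"
  have \<omega>: "0 \<le> \<omega> K" if "K \<in> V" for K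
    unfolding \<omega>_def using w_nonneg[OF that] by (intro sum_nonneg)
  have \<omega>_le: "\<omega> K \<le> W" if "K \<in> V" for K
    unfolding W_def using that finite_V \<omega> by (intro member_le_sum) auto
  have "0 \<le> W"
    unfolding W_def using \<omega> by (intro sum_nonneg)
  then have q: "0 \<le> q" "q < 1"
    using c by (auto simp: q_def)
  \<comment> \<open>Moving the neighbour values to the right leaves the positive coefficient
    \<open>c + \<omega> K\<close> on the unknown \<open>s\<close>, so on \<open>V\<close> the choice
    is from a nonempty set.\<close>
  define F where "F x K = (SOME s. (c + \<omega> K) * s + h K s = (\<Sum>L\<in>nb K. w K L * x L) + f K)" for x K
  have F: "(c + \<omega> K) * F x K + h K (F x K) = (\<Sum>L\<in>nb K. w K L * x L) + f K" if "K \<in> V" for x K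
  proof -
    have "0 < c + \<omega> K"
      using c \<omega>[OF that] by simp
    then show ?thesis
      unfolding F_def by (intro someI_ex[OF strongly_increasing_surj] h that)
  qed
  have contraction: "\<bar>F x K - F y K\<bar> \<le> q * D"
    if D: "\<And>L. L \<in> V \<Longrightarrow> \<bar>x L - y L\<bar> \<le> D" and K: "K \<in> V" for x y D K
  proof -
    have "0 \<le> D"
      using D[OF K] by linarith
    have pos: "0 < c + \<omega> K"
      using c \<omega>[OF K] by simp
    have "(c + \<omega> K) * \<bar>F x K - F y K\<bar> \<le> \<bar>(\<Sum>L\<in>nb K. w K L * x L) - (\<Sum>L\<in>nb K. w K L * y L)\<bar>"
      using strongly_increasing_dist[OF pos h(1)[OF K], of "F x K" "F y K"] F[OF K, of x] F[OF K, of y]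
      by simp
    also have "\<dots> = \<bar>\<Sum>L\<in>nb K. w K L * (x L - y L)\<bar>"
      by (simp add: sum_subtractf right_diff_distrib)
    also have "\<dots> \<le> (\<Sum>L\<in>nb K. \<bar>w K L * (x L - y L)\<bar>)"
      by (rule sum_abs)
    also have "\<dots> \<le> (\<Sum>L\<in>nb K. w K L * D)"
      using w_nonneg[OF K] D nb_subset[OF K]
      by (intro sum_mono) (auto simp: abs_mult intro!: mult_left_mono)
    also have "\<dots> = \<omega> K * D"
      by (simp add: \<omega>_def sum_distrib_right)
    finally have "\<bar>F x K - F y K\<bar> \<le> \<omega> K / (c + \<omega> K) * D"
      using pos by (simp add: field_simps)
    \<comment> \<open>The map taking t to t / (c + t) is increasing on nonnegative t, and
      \<open>\<omega> K \<le> W\<close>.\<close>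
    also have "\<dots> \<le> q * D"
      using c \<omega>[OF K] \<omega>_le[OF K] \<open>0 \<le> W\<close> \<open>0 \<le> D\<close> unfolding q_def
      by (intro mult_right_mono) (auto simp: divide_simps algebra_simps)
    finally show ?thesis .
  qed
  define x where "x n = (F ^^ n) (\<lambda>_. 0)" for n
  have x_Suc: "x (Suc n) = F (x n)" for n
    by (simp add: x_def)
  define D where "D = (\<Sum>K\<in>V. \<bar>x 1 K - x 0 K\<bar>)"
  have diff: "\<bar>x (Suc n) K - x n K\<bar> \<le> q ^ n * D" if "K \<in> V" for n K
    using that
  proof (induction n arbitrary: K)
    case 0
    then show ?case
      using finite_V member_le_sum[of K V "\<lambda>K. \<bar>x 1 K - x 0 K\<bar>"] by (auto simp: D_def)
  next
    case (Suc n)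
    then show ?case
      using contraction[of "x (Suc n)" "x n" "q ^ n * D" K] by (simp add: x_Suc mult.assoc)
  qed
  have "convergent (\<lambda>n. x n K)" if K: "K \<in> V" for K
  proof -
    \<comment> \<open>The increments are dominated by a geometric series, and their partial sums
      telescope.\<close>
    have "summable (\<lambda>n. x (Suc n) K - x n K)"
    proof (rule summable_comparison_test')
      show "summable (\<lambda>n. q ^ n * D)"
        using q by (intro summable_mult2 summable_geometric) simp
    qed (use diff[OF K] in auto)
    then have "convergent (\<lambda>n. \<Sum>i<n. x (Suc i) K - x i K)"
      by (simp add: summable_iff_convergent)
    then have "convergent (\<lambda>n. x n K - x 0 K)"
      by (simp add: sum_lessThan_telescope[of "\<lambda>i. x i K"])
    from convergent_add[OF this convergent_const[of "x 0 K"]] show ?thesis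
      by simp
  qed
  then obtain z where z: "(\<lambda>n. x n K) \<longlonglongrightarrow> z K" if "K \<in> V" for K
    unfolding convergent_def by metis
  have "lhs c h z K = f K" if K: "K \<in> V" for K
  proof -
    have zS: "(\<lambda>n. x (Suc n) K) \<longlonglongrightarrow> z K"
      using z[OF K] by (rule LIMSEQ_Suc)
    \<comment> \<open>Continuity of \<open>h K\<close> allows passing to the limit in the equation
      that characterises \<open>F\<close>, so the limit is a fixed point.\<close>
    have "isCont (h K) (z K)"
      using h(2)[OF K] by (simp add: continuous_on_eq_continuous_at)
    then have "(\<lambda>n. (c + \<omega> K) * x (Suc n) K + h K (x (Suc n) K)) \<longlonglongrightarrow> (c + \<omega> K) * z K + h K (z K)"
      using zS by (intro tendsto_intros isCont_tendsto_compose[of "z K" "h K"])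
    then have "(\<lambda>n. (\<Sum>L\<in>nb K. w K L * x n L) + f K) \<longlonglongrightarrow> (c + \<omega> K) * z K + h K (z K)"
      by (simp add: x_Suc F[OF K])
    moreover have "(\<lambda>n. (\<Sum>L\<in>nb K. w K L * x n L) + f K) \<longlonglongrightarrow> (\<Sum>L\<in>nb K. w K L * z L) + f K"
      using nb_subset[OF K] z by (intro tendsto_intros) auto
    ultimately have "(c + \<omega> K) * z K + h K (z K) = (\<Sum>L\<in>nb K. w K L * z L) + f K"
      by (rule LIMSEQ_unique)
    then show ?thesis
      by (simp add: lhs_def \<omega>_def algebra_simps sum_subtractf sum_distrib_left)
  qed
  then show ?thesis
    by blast
qed

end

text \<open>The modulus turns the fourth power into an odd function, so the negative half-line
  reduces to the positive one.\<close>

lemma mono_abs_mult_cube: "mono (\<lambda>s::real. \<bar>s\<bar> * s ^ 3)"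
proof (rule monoI)
  fix s t :: real
  assume "s \<le> t"
  consider "0 \<le> s" | "s < 0" "0 \<le> t" | "t < 0"
    by linarith
  then show "\<bar>s\<bar> * s ^ 3 \<le> \<bar>t\<bar> * t ^ 3"
  proof cases
    case 1
    then show ?thesis
      using \<open>s \<le> t\<close> by (intro mult_mono power_mono) auto
  next
    case 2
    then have "\<bar>s\<bar> * s ^ 3 \<le> 0" "0 \<le> \<bar>t\<bar> * t ^ 3"
      by (intro mult_nonneg_nonpos mult_nonneg_nonneg; simp add: power_le_zero_eq)+
    then show ?thesis
      by linarith
  next
    case 3
    then have "\<bar>t\<bar> * (- t) ^ 3 \<le> \<bar>s\<bar> * (- s) ^ 3"
      using \<open>s \<le> t\<close> by (intro mult_mono power_mono) auto
    then show ?thesis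
      by simp
  qed
qed

section \<open>Piecewise constant functions and the data\<close>

lemma cell_value_eqI:
  assumes "x \<in> K" and "\<And>y. y \<in> K \<Longrightarrow> u y = c"
  shows "cell_value u K = c"
  unfolding cell_value_def using assms by (intro the_equality) auto

lemma HM_apply:
  assumes "u \<in> HM M" and "K \<in> M" and "x \<in> K"
  shows "u x = cell_value u K"
proof -
  obtain c where "\<And>y. y \<in> K \<Longrightarrow> u y = c"
    using assms(1,2) unfolding HM_def constant_on_def by blast
  with assms(3) show ?thesis
    using cell_value_eqI[of x K u c] by simp
qed

text \<open>Carries uniqueness over from cell values to functions; off the cells both
  representatives vanish.\<close>

lemma HM_eqI:
  assumes "u \<in> HM M" and "v \<in> HM M" and "\<And>K. K \<in> M \<Longrightarrow> cell_value u K = cell_value v K"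
  shows "u = v"
proof
  fix x
  show "u x = v x"
  proof (cases "x \<in> \<Union>M")
    case True
    then obtain K where "K \<in> M" "x \<in> K"
      by blast
    then show ?thesis
      using HM_apply[OF assms(1)] HM_apply[OF assms(2)] assms(3) by simp
  next
    case False
    then show ?thesis
      using assms(1,2) by (simp add: HM_def)
  qed
qed

text \<open>A right inverse of \<open>cell_value\<close> when the cells are disjoint and nonempty.
  The value 0 off the cells is the one prescribed by \<open>HM\<close>.\<close>

definition cellwise :: "'a set set \<Rightarrow> ('a set \<Rightarrow> real) \<Rightarrow> 'a \<Rightarrow> real" where
  "cellwise M a x = (if x \<in> \<Union>M then a (THE K. K \<in> M \<and> x \<in> K) else 0)"

lemma cellwise_apply:
  assumes "disjoint M" and "K \<in> M" and "x \<in> K"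
  shows "cellwise M a x = a K"
proof -
  have "(THE K. K \<in> M \<and> x \<in> K) = K"
    using assms by (intro the_equality) (auto simp: disjoint_def pairwise_def disjnt_def)
  then show ?thesis
    using assms by (auto simp: cellwise_def)
qed

lemma cellwise_HM: "disjoint M \<Longrightarrow> cellwise M a \<in> HM M"
  unfolding HM_def constant_on_def using cellwise_apply[of M _ _ a]
  by (auto simp: cellwise_def)

lemma cell_value_cellwise:
  assumes "disjoint M" and "K \<in> M" and "x \<in> K"
  shows "cell_value (cellwise M a) K = a K"
  using assms cellwise_apply by (intro cell_value_eqI) auto

text \<open>The pieces of the boundary have codimension one, hence empty interior, and a convex set
  with empty interior is null.\<close>

lemma polyhedral_domain_negligible_frontier:
  fixes \<Omega> :: "'a::euclidean_space set"
  assumes "polyhedral_domain \<Omega>"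
  shows "negligible (frontier \<Omega>)"
proof -
  obtain F where F: "finite F" "frontier \<Omega> = \<Union>F"
    "\<And>P. P \<in> F \<Longrightarrow> polytope P \<and> aff_dim P = int DIM('a) - 1"
    using assms unfolding polyhedral_domain_def by blast
  have "negligible P" if "P \<in> F" for P
    using F(3)[OF that] low_dim_interior[of P] negligible_convex_interior[of P]
    by (auto simp: polytope_imp_convex)
  then show ?thesis
    using F by (simp add: negligible_Union)
qed

text \<open>A control volume need not be contained in \<open>\<Omega>\<close>, which may have a slit inside it.\<close>

lemma set_integral_nonneg_closure:
  fixes u0 :: "'a::euclidean_space \<Rightarrow> real"
  assumes "open \<Omega>" and "negligible (frontier \<Omega>)"
    and "AE x in lebesgue_on \<Omega>. 0 \<le> u0 x" and "K \<subseteq> closure \<Omega>"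
  shows "0 \<le> (LINT x:K|lebesgue. u0 x)"
proof -
  have "AE x in lebesgue. x \<in> \<Omega> \<longrightarrow> 0 \<le> u0 x"
    using assms(1,3) by (subst (asm) AE_restrict_space_iff) auto
  moreover have "AE x in lebesgue. x \<notin> frontier \<Omega>"
    using assms(2) by (intro AE_not_in) (simp add: negligible_iff_null_sets)
  \<comment> \<open>A point of \<open>K\<close> off the frontier lies in \<open>\<Omega>\<close>
    itself.\<close>
  ultimately have "AE x in lebesgue. 0 \<le> indicator K x *\<^sub>R u0 x"
  proof eventually_elim
    case (elim x)
    then show ?case
      using assms(1,4) by (auto simp: frontier_def interior_open indicator_def)
  qed
  \<comment> \<open>If the integrand is not integrable, the integral is 0 by convention, so the sign
    holds in either case.\<close>
  then show ?thesis
    unfolding set_lebesgue_integral_def by (rule integral_nonneg_AE)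
qed

section \<open>The discrete Laplacians and the scheme\<close>

text \<open>With the factor coming from the measure of \<open>K\<close> included, the weight is in
  general not symmetric; the graph argument uses only its sign.\<close>

definition transmissibility :: "'a::euclidean_space set \<Rightarrow> 'a set \<Rightarrow> real" where
  "transmissibility K L = 1 / measure lebesgue K *
     (face_measure (closure K \<inter> closure L) / dist (circumcenter K) (circumcenter L))"

definition boundary_transmissibility :: "'a::euclidean_space set \<Rightarrow> 'a set \<Rightarrow> real" where
  "boundary_transmissibility \<Omega> K = 1 / measure lebesgue K *
     (\<Sum>\<sigma>\<in>ext_faces \<Omega> K. face_measure \<sigma> / infdist (circumcenter K) \<sigma>)"

lemma transmissibility_nonneg: "0 \<le> transmissibility K L"
  by (simp add: transmissibility_def face_measure_def)

lemma boundary_transmissibility_nonneg: "0 \<le> boundary_transmissibility \<Omega> K"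
  unfolding boundary_transmissibility_def face_measure_def
  by (intro mult_nonneg_nonneg sum_nonneg divide_nonneg_nonneg infdist_nonneg) auto

lemma laplace_N_eq:
  "laplace_N \<Omega> M \<psi> K =
    - (\<Sum>L\<in>neighbours \<Omega> M K. transmissibility K L * (cell_value \<psi> K - cell_value \<psi> L))"
  unfolding laplace_N_def transmissibility_def sum_distrib_left sum_negf[symmetric]
  by (intro sum.cong refl) (simp only: minus_mult_right minus_diff_eq mult.assoc)

lemma laplace_D_eq:
  "laplace_D \<Omega> M \<psi> K = laplace_N \<Omega> M \<psi> K - boundary_transmissibility \<Omega> K * cell_value \<psi> K"
  unfolding laplace_D_def boundary_transmissibility_def sum_distrib_right[symmetric] by simp

text \<open>A boundary face acts like an edge to a vertex of value 0, so its contribution depends on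
  \<open>s\<close> alone and can join the nonlinear term.\<close>

definition reaction :: "'a::euclidean_space set \<Rightarrow> 'a set \<Rightarrow> real \<Rightarrow> real" where
  "reaction \<Omega> K s = boundary_transmissibility \<Omega> K * s + \<bar>s\<bar> * s ^ 3"

lemma mono_reaction: "mono (reaction \<Omega> K)"
  using mono_abs_mult_cube boundary_transmissibility_nonneg[of \<Omega> K]
  by (auto simp: mono_def reaction_def intro!: add_mono mult_left_mono)

lemma continuous_reaction: "continuous_on UNIV (reaction \<Omega> K)"
  unfolding reaction_def by (intro continuous_intros)

text \<open>Lets the reaction at a constant \<open>m\<close> absorb a source of size up to
  \<open>m ^ 4\<close>.\<close>

lemma reaction_ge: "0 \<le> s \<Longrightarrow> s ^ 4 \<le> reaction \<Omega> K s"
  using boundary_transmissibility_nonneg[of \<Omega> K]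
  by (simp add: reaction_def power4_eq_xxxx power3_eq_cube mult.assoc)

text \<open>Isolates what is used of the mesh. Nonempty cells are required for
  \<open>cell_value\<close> to be determined.\<close>

locale mesh_graph = weighted_graph M "neighbours \<Omega> M" transmissibility
  for \<Omega> :: "'a::euclidean_space set" and M :: "'a set set" +
  fixes \<tau> :: real
  assumes disj: "disjoint M" and nonempty: "K \<in> M \<Longrightarrow> K \<noteq> {}" and \<tau>_pos: "0 < \<tau>"
begin

abbreviation lhs_N :: "('a set \<Rightarrow> real) \<Rightarrow> 'a set \<Rightarrow> real" where
  "lhs_N \<equiv> lhs 1 (\<lambda>_ _. 0)"

abbreviation lhs_D :: "('a set \<Rightarrow> real) \<Rightarrow> 'a set \<Rightarrow> real" where
  "lhs_D \<equiv> lhs (1 / \<tau>) (reaction \<Omega>)"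

lemma mono_zero: "mono (\<lambda>_. 0 :: real)"
  by (simp add: mono_def)

lemma equation_N_iff:
  "cell_value \<phi> K - laplace_N \<Omega> M \<phi> K - f = 0 \<longleftrightarrow> lhs_N (cell_value \<phi>) K = f"
  by (auto simp: lhs_def laplace_N_eq)

lemma equation_D_iff:
  "(cell_value u K - v) / \<tau> - laplace_D \<Omega> M u K + \<bar>cell_value u K\<bar> * cell_value u K ^ 3 - f = 0
    \<longleftrightarrow> lhs_D (cell_value u) K = v / \<tau> + f"
  by (auto simp: lhs_def laplace_N_eq laplace_D_eq reaction_def diff_divide_distrib)

text \<open>The sum over the neighbours vanishes on constants, so 0 is a subsolution and
  \<open>m ^ 4\<close> a supersolution.\<close>

lemma bounds_N:
  assumes "\<And>K. K \<in> M \<Longrightarrow> 0 \<le> v K \<and> v K \<le> m" and "\<And>K. K \<in> M \<Longrightarrow> lhs_N p K = v K ^ 4" and "K \<in> M"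
  shows "0 \<le> p K" and "p K \<le> m ^ 4"
proof -
  have "0 \<le> lhs_N p K \<and> lhs_N p K \<le> m ^ 4" if "K \<in> M" for K
    using assms(1,2)[OF that] by (auto intro: power_mono)
  then show "0 \<le> p K" "p K \<le> m ^ 4"
    using assms(3) comparison[of 1 "\<lambda>_ _. 0" "\<lambda>_. 0" p K] comparison[of 1 "\<lambda>_ _. 0" p "\<lambda>_. m ^ 4" K]
    by (simp_all add: lhs_const mono_zero)
qed

lemma bounds_D:
  assumes "\<And>K. K \<in> M \<Longrightarrow> 0 \<le> v K \<and> v K \<le> m" and "\<And>K. K \<in> M \<Longrightarrow> 0 \<le> p K \<and> p K \<le> m ^ 4"
    and "\<And>K. K \<in> M \<Longrightarrow> lhs_D x K = v K / \<tau> + p K" and "K \<in> M"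
  shows "0 \<le> x K" and "x K \<le> m"
proof -
  have "0 \<le> m"
    using assms(1)[OF assms(4)] by linarith
  \<comment> \<open>The constant \<open>m\<close> is a supersolution because one \<open>m\<close>
    bounds both data: \<open>m / \<tau>\<close> dominates the previous values and the reaction
    dominates the source \<open>p\<close>.\<close>
  have "lhs_D (\<lambda>_. 0) K \<le> lhs_D x K \<and> lhs_D x K \<le> lhs_D (\<lambda>_. m) K" if "K \<in> M" for K
  proof -
    have "0 \<le> v K / \<tau>" "v K / \<tau> \<le> m / \<tau>"
      using assms(1)[OF that] \<tau>_pos by (auto intro: divide_right_mono)
    then show ?thesis
      using assms(2,3)[OF that] reaction_ge[OF \<open>0 \<le> m\<close>, of \<Omega> K]
      by (auto simp: lhs_const) (simp add: reaction_def)
  qed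
  then show "0 \<le> x K" "x K \<le> m"
    using assms(4) \<tau>_pos comparison[of "1 / \<tau>" "reaction \<Omega>" "\<lambda>_. 0" x K]
      comparison[of "1 / \<tau>" "reaction \<Omega>" x "\<lambda>_. m" K]
    by (simp_all add: mono_reaction)
qed

lemma lhs_N_inj:
  assumes "\<And>K. K \<in> M \<Longrightarrow> lhs_N p K = lhs_N q K" and "K \<in> M"
  shows "p K = q K"
  using lhs_inj[of 1 "\<lambda>_ _. 0" p q] assms by (simp add: mono_zero)

lemma lhs_D_inj:
  assumes "\<And>K. K \<in> M \<Longrightarrow> lhs_D x K = lhs_D y K" and "K \<in> M"
  shows "x K = y K"
  using lhs_inj[OF _ mono_reaction assms] \<tau>_pos by simp

lemma solvable_N: "\<exists>p. \<forall>K\<in>M. lhs_N p K = f K"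
  using solvable[of 1 "\<lambda>_ _. 0" f] by (simp add: mono_zero)

lemma solvable_D: "\<exists>x. \<forall>K\<in>M. lhs_D x K = f K"
  using solvable[of "1 / \<tau>" "reaction \<Omega>" f] \<tau>_pos by (simp add: mono_reaction continuous_reaction)

lemma cell_value_cellwise': "K \<in> M \<Longrightarrow> cell_value (cellwise M a) K = a K"
  using cell_value_cellwise[OF disj] nonempty by blast

end

section \<open>Existence, uniqueness and bounds for the scheme\<close>

context
  fixes \<Omega> :: "'a::euclidean_space set" and M :: "'a set set" and T :: real and N :: nat
    and u0 :: "'a \<Rightarrow> real"
  assumes graph: "mesh_graph \<Omega> M (T / real N)"
begin

interpretation mesh_graph \<Omega> M "T / real N"
  by (rule graph)

text \<open>Merges the initial equation for \<open>\<phi>\<close> with those at the later times, so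
  that a single Neumann problem holds for all \<open>n \<le> N\<close>.\<close>

lemma scheme_solution_iff:
  "scheme_solution \<Omega> M T N u0 u \<phi> \<longleftrightarrow>
     u \<in> {0..N} \<rightarrow>\<^sub>E HM M \<and> \<phi> \<in> {0..N} \<rightarrow>\<^sub>E HM M \<and>
     (\<forall>n<N. \<forall>K\<in>M. lhs_D (cell_value (u (Suc n))) K
        = cell_value (u n) K / (T / real N) + cell_value (\<phi> n) K) \<and>
     (\<forall>n\<le>N. \<forall>K\<in>M. lhs_N (cell_value (\<phi> n)) K = cell_value (u n) K ^ 4) \<and>
     (\<forall>K\<in>M. cell_value (u 0) K = 1 / measure lebesgue K * (LINT x:K|lebesgue. u0 x))"
proof -
  have split: "(\<forall>n\<le>N. P n) \<longleftrightarrow> P 0 \<and> (\<forall>n<N. P (Suc n))" for P :: "nat \<Rightarrow> bool"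
    using All_less_Suc2[of N P] by (simp add: less_Suc_eq_le)
  show ?thesis
    unfolding scheme_solution_def equation_N_iff equation_D_iff split ball_conj_distrib
    by (simp only: conj_ac)
qed

lemma scheme_solution_exists: "\<exists>u \<phi>. scheme_solution \<Omega> M T N u0 u \<phi>"
proof -
  \<comment> \<open>A state pairs the cell values of u and \<open>\<phi>\<close> at one time.
    \<open>P\<close> is the Neumann problem within a state, with the initial condition at time 0;
    \<open>Q\<close> is the time step between states.\<close>
  define P where "P n s \<longleftrightarrow> (\<forall>K\<in>M. lhs_N (snd s) K = fst s K ^ 4) \<and>
      (n = 0 \<longrightarrow> (\<forall>K\<in>M. fst s K = 1 / measure lebesgue K * (LINT x:K|lebesgue. u0 x)))"
    for n :: nat and s
  define Q where "Q n s s' \<longleftrightarrow> (\<forall>K\<in>M. lhs_D (fst s') K = fst s K / (T / real N) + snd s K)"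
    for n :: nat and s s' :: "('a set \<Rightarrow> real) \<times> ('a set \<Rightarrow> real)"
  have "\<exists>s. \<forall>n. P n (s n) \<and> Q n (s n) (s (Suc n))"
  proof (rule dependent_nat_choice)
    obtain p where "\<forall>K\<in>M. lhs_N p K = (1 / measure lebesgue K * (LINT x:K|lebesgue. u0 x)) ^ 4"
      using solvable_N[of "\<lambda>K. (1 / measure lebesgue K * (LINT x:K|lebesgue. u0 x)) ^ 4"] by blast
    then show "\<exists>s. P 0 s"
      by (intro exI[of _ "(\<lambda>K. 1 / measure lebesgue K * (LINT x:K|lebesgue. u0 x), p)"]) (simp add: P_def)
  next
    fix s n
    obtain x where "\<forall>K\<in>M. lhs_D x K = fst s K / (T / real N) + snd s K"
      using solvable_D[of "\<lambda>K. fst s K / (T / real N) + snd s K"] by blast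
    moreover obtain p where "\<forall>K\<in>M. lhs_N p K = x K ^ 4"
      using solvable_N[of "\<lambda>K. x K ^ 4"] by blast
    ultimately show "\<exists>s'. P (Suc n) s' \<and> Q n s s'"
      by (intro exI[of _ "(x, p)"]) (simp add: P_def Q_def)
  qed
  then obtain s where s: "\<And>n. P n (s n)" "\<And>n. Q n (s n) (s (Suc n))"
    by blast
  \<comment> \<open>The states are built for all times and then cut off at \<open>N\<close>, as
    extensionality demands.\<close>
  define u where "u = (\<lambda>n\<in>{0..N}. cellwise M (fst (s n)))"
  define \<phi> where "\<phi> = (\<lambda>n\<in>{0..N}. cellwise M (snd (s n)))"
  have val: "cell_value (u n) K = fst (s n) K" "cell_value (\<phi> n) K = snd (s n) K"
    if "n \<le> N" "K \<in> M" for n K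
    using that by (simp_all add: u_def \<phi>_def cell_value_cellwise')
  have op: "lhs c h (cell_value (u n)) K = lhs c h (fst (s n)) K"
    "lhs c h (cell_value (\<phi> n)) K = lhs c h (snd (s n)) K"
    if "n \<le> N" "K \<in> M" for n K c h
    using that val by (auto intro!: lhs_cong)
  have "u \<in> {0..N} \<rightarrow>\<^sub>E HM M" "\<phi> \<in> {0..N} \<rightarrow>\<^sub>E HM M"
    by (auto simp: u_def \<phi>_def cellwise_HM[OF disj])
  then have "scheme_solution \<Omega> M T N u0 u \<phi>"
    using s unfolding scheme_solution_iff P_def Q_def by (auto simp: val op)
  then show ?thesis
    by blast
qed

text \<open>The unknowns are determined in turn: \<open>u n\<close> fixes \<open>\<phi> n\<close>,
  and the two together fix \<open>u (Suc n)\<close>.\<close>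

lemma scheme_solution_unique:
  assumes "scheme_solution \<Omega> M T N u0 u \<phi>" and "scheme_solution \<Omega> M T N u0 v \<psi>"
  shows "u = v \<and> \<phi> = \<psi>"
proof -
  note U = assms(1)[unfolded scheme_solution_iff] and V = assms(2)[unfolded scheme_solution_iff]
  have \<phi>_eq: "\<forall>K\<in>M. cell_value (\<phi> n) K = cell_value (\<psi> n) K"
    if n: "n \<le> N" and u: "\<forall>K\<in>M. cell_value (u n) K = cell_value (v n) K" for n
  proof
    fix K
    assume "K \<in> M"
    have "lhs_N (cell_value (\<phi> n)) J = lhs_N (cell_value (\<psi> n)) J" if "J \<in> M" for J
      using U V n u that by metis
    then show "cell_value (\<phi> n) K = cell_value (\<psi> n) K"
      using \<open>K \<in> M\<close> by (rule lhs_N_inj)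
  qed
  have u_eq: "\<forall>K\<in>M. cell_value (u n) K = cell_value (v n) K" if "n \<le> N" for n
    using that
  proof (induction n)
    case 0
    then show ?case
      using U V by simp
  next
    case (Suc n)
    then have n: "n < N" and IH: "\<forall>K\<in>M. cell_value (u n) K = cell_value (v n) K"
      by auto
    show ?case
    proof
      fix K
      assume "K \<in> M"
      have "lhs_D (cell_value (u (Suc n))) J = lhs_D (cell_value (v (Suc n))) J" if "J \<in> M" for J
        using U V n IH \<phi>_eq[OF less_imp_le[OF n] IH] that by metis
      then show "cell_value (u (Suc n)) K = cell_value (v (Suc n)) K"
        using \<open>K \<in> M\<close> by (rule lhs_D_inj)
    qed
  qed
  have eq: "u n = v n" "\<phi> n = \<psi> n" if n: "n \<in> {0..N}" for n
  proof -
    have mem: "u n \<in> HM M" "v n \<in> HM M" "\<phi> n \<in> HM M" "\<psi> n \<in> HM M"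
      using U V n by (meson PiE_mem)+
    show "u n = v n"
      using mem(1,2) u_eq[of n] n by (intro HM_eqI) auto
    show "\<phi> n = \<psi> n"
      using mem(3,4) \<phi>_eq[of n] u_eq[of n] n by (intro HM_eqI) auto
  qed
  have "u = v"
    using U V eq(1) by (intro PiE_ext[of u "{0..N}" "\<lambda>_. HM M" v]) auto
  moreover have "\<phi> = \<psi>"
    using U V eq(2) by (intro PiE_ext[of \<phi> "{0..N}" "\<lambda>_. HM M" \<psi>]) auto
  ultimately show ?thesis ..
qed

text \<open>Nonnegativity of \<open>u n\<close> is the invariant of the induction: it yields the
  bounds on \<open>\<phi> n\<close>, and these yield the bounds on \<open>u (Suc n)\<close>,
  including its sign.\<close>

lemma scheme_solution_bounds:
  assumes sol: "scheme_solution \<Omega> M T N u0 u \<phi>"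
    and init: "\<And>K. K \<in> M \<Longrightarrow> 0 \<le> (LINT x:K|lebesgue. u0 x)"
    and n: "n \<le> N"
  shows "\<forall>K\<in>M. 0 \<le> cell_value (u n) K"
    and "\<forall>K\<in>M. 0 \<le> cell_value (\<phi> n) K \<and> cell_value (\<phi> n) K \<le> (Max (cell_value (u n) ` M)) ^ 4"
    and "n < N \<Longrightarrow> \<forall>K\<in>M. 0 \<le> cell_value (u (Suc n)) K \<and>
           cell_value (u (Suc n)) K \<le> Max (cell_value (u n) ` M)"
proof -
  note S = sol[unfolded scheme_solution_iff]
  have max: "cell_value (u n) K \<le> Max (cell_value (u n) ` M)" if "K \<in> M" for n K
    using that finite_V by auto
  have \<phi>: "\<forall>K\<in>M. 0 \<le> cell_value (\<phi> n) K \<and> cell_value (\<phi> n) K \<le> (Max (cell_value (u n) ` M)) ^ 4"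
    if "n \<le> N" "\<forall>K\<in>M. 0 \<le> cell_value (u n) K" for n
    using that S max[of _ n] bounds_N[of "cell_value (u n)" "Max (cell_value (u n) ` M)" "cell_value (\<phi> n)"]
    by simp
  have u: "\<forall>K\<in>M. 0 \<le> cell_value (u (Suc n)) K \<and> cell_value (u (Suc n)) K \<le> Max (cell_value (u n) ` M)"
    if "n < N" "\<forall>K\<in>M. 0 \<le> cell_value (u n) K" for n
    using that S \<phi>[of n] max[of _ n]
      bounds_D[of "cell_value (u n)" "Max (cell_value (u n) ` M)" "cell_value (\<phi> n)" "cell_value (u (Suc n))"]
    by simp
  show nonneg: "\<forall>K\<in>M. 0 \<le> cell_value (u n) K"
    using n
  proof (induction n)
    case 0
    then show ?case
      using S init by simp
  next
    case (Suc n)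
    then show ?case
      using u[of n] by simp
  qed
  show "\<forall>K\<in>M. 0 \<le> cell_value (\<phi> n) K \<and> cell_value (\<phi> n) K \<le> (Max (cell_value (u n) ` M)) ^ 4"
    using \<phi>[OF n nonneg] .
  show "n < N \<Longrightarrow> \<forall>K\<in>M. 0 \<le> cell_value (u (Suc n)) K \<and>
           cell_value (u (Suc n)) K \<le> Max (cell_value (u n) ` M)"
    using u nonneg by blast
qed

end

theorem proposition3p1:
  fixes \<Omega> :: "(real ^ 'n) set" and M :: "(real ^ 'n) set set"
    and u0 :: "real ^ 'n \<Rightarrow> real" and T :: real and N :: nat
  assumes "CARD('n) = 2 \<or> CARD('n) = 3"
    and "open \<Omega>" and "bounded \<Omega>" and "connected \<Omega>" and "polyhedral_domain \<Omega>"
    and "0 < T"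
    and "u0 \<in> Linfty \<Omega> \<inter> H10 \<Omega>" and "AE x in lebesgue_on \<Omega>. 0 \<le> u0 x"
    and "simplicial_mesh \<Omega> M"
    and "1 \<le> N"
  shows "(\<exists>!(u, \<phi>). scheme_solution \<Omega> M T N u0 u \<phi>) \<and>
    (\<forall>u \<phi>. scheme_solution \<Omega> M T N u0 u \<phi> \<longrightarrow>
      (\<forall>n\<in>{0..N}. \<forall>K\<in>M.
         0 \<le> cell_value (\<phi> n) K \<and>
         cell_value (\<phi> n) K \<le> (Max ((\<lambda>L. cell_value (u n) L) ` M)) ^ 4) \<and>
      (\<forall>n\<in>{1..N}. \<forall>K\<in>M.
         0 \<le> cell_value (u n) K \<and>
         cell_value (u n) K \<le> Max ((\<lambda>L. cell_value (u (n - 1)) L) ` M)))"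
proof -
  note mesh = \<open>simplicial_mesh \<Omega> M\<close>[unfolded simplicial_mesh_def]
  have graph: "mesh_graph \<Omega> M (T / real N)"
  proof unfold_locales
    show "finite M" "disjoint M"
      using mesh by auto
    show "neighbours \<Omega> M K \<subseteq> M" for K
      by (auto simp: neighbours_def)
    show "0 \<le> transmissibility K L" for K L :: "(real ^ 'n) set"
      by (rule transmissibility_nonneg)
    \<comment> \<open>The circumcenter of \<open>K\<close> lies in \<open>K\<close>.\<close>
    show "K \<noteq> {}" if "K \<in> M" for K
      using mesh that by fastforce
    show "0 < T / real N"
      using \<open>0 < T\<close> \<open>1 \<le> N\<close> by simp
  qed
  have init: "0 \<le> (LINT x:K|lebesgue. u0 x)" if "K \<in> M" for K
  proof (rule set_integral_nonneg_closure)
    show "K \<subseteq> closure \<Omega>"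
      using mesh that closure_subset[of K] by auto
  qed (use assms polyhedral_domain_negligible_frontier in auto)
  have "\<exists>!s. case s of (u, \<phi>) \<Rightarrow> scheme_solution \<Omega> M T N u0 u \<phi>"
    using scheme_solution_exists[OF graph, of u0] scheme_solution_unique[OF graph, of u0]
    by (auto intro!: ex_ex1I)
  \<comment> \<open>The bound at a time \<open>n \<ge> 1\<close> is that for the time step starting
    at \<open>n - 1\<close>.\<close>
  moreover have "cell_value (u n) K \<le> Max (cell_value (u (n - 1)) ` M) \<and> 0 \<le> cell_value (u n) K"
    if "scheme_solution \<Omega> M T N u0 u \<phi>" "n \<in> {1..N}" "K \<in> M" for u \<phi> n K
    using scheme_solution_bounds(3)[OF graph that(1) init, of "n - 1"] that by auto
  ultimately show ?thesis
    using scheme_solution_bounds(2)[OF graph _ init] by simp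
qed

end
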